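(* Let $G$ be a graph satisfying $\mathrm{CD}(K,\infty)$ with $K>0$. If $\lambda_1(G)=K$, then $K=\mathcal{K}_\infty(x)=2$ for every vertex $x\in V(G)$.
   Context: All graphs are simple, finite, connected and unweighted. For $f:V(G)\to\mathbb{R}$ put $Lf(x)=\sum_{y\sim x}(f(y)-f(x))$. The eigenvalues of $-L$ are $0=\lambda_0<\lambda_1\le\lambda_2\le\cdots$, counted with multiplicity. The Bakry--Émery operators are $2\Gamma(f,g)=L(fg)-fLg-gLf$ and $2\Gamma_2(f,g)=L\Gamma(f,g)-\Gamma(f,Lg)-\Gamma(g,Lf)$, with $\Gamma(f)=\Gamma(f,f)$ and $\Gamma_2(f)=\Gamma_2(f,f)$. $G$ satisfies $\mathrm{CD}(K,\infty)$ at a vertex $x$ if $\Gamma_2(f)(x)\ge K\,\Gamma(f)(x)$ for all $f:V(G)\to\mathbb{R}$; it satisfies $\mathrm{CD}(K,\infty)$ if this holds at every vertex. The curvature at $x$ is $\mathcal{K}_\infty(x)=\sup\{K\in\mathbb{R}: G\text{ satisfies }\mathrm{CD}(K,\infty)\text{ at }x\}$. *)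

theory Defs
  imports
    "HOL-Library.Function_Algebras"
    "HOL-Library.Multiset"
    "HOL-Library.Extended_Real"
    "Graph_Theory.Graph_Theory"
begin

text \<open>
  Finite simple graphs are those satisfying \<^locale>\<open>pair_graph\<close>: a finite vertex set
  \<^term>\<open>pverts G\<close> and a symmetric, loop-free adjacency relation \<^term>\<open>parcs G\<close>.
  A function on the vertices is a total function \<^typ>\<open>'a \<Rightarrow> real\<close>; for vertices \<open>x\<close> none of
  the operators below looks at values outside \<^term>\<open>pverts G\<close>.
\<close>

definition laplacian :: "'a pair_pre_digraph \<Rightarrow> ('a \<Rightarrow> real) \<Rightarrow> 'a \<Rightarrow> real" where
  "laplacian G f x = (\<Sum>y\<in>{y. (x, y) \<in> parcs G}. f y - f x)"

definition Gamma :: "'a pair_pre_digraph \<Rightarrow> ('a \<Rightarrow> real) \<Rightarrow> ('a \<Rightarrow> real) \<Rightarrow> 'a \<Rightarrow> real" where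
  "Gamma G f g x =
     (laplacian G (\<lambda>y. f y * g y) x - f x * laplacian G g x - g x * laplacian G f x) / 2"

definition Gamma2 :: "'a pair_pre_digraph \<Rightarrow> ('a \<Rightarrow> real) \<Rightarrow> ('a \<Rightarrow> real) \<Rightarrow> 'a \<Rightarrow> real" where
  "Gamma2 G f g x =
     (laplacian G (Gamma G f g) x - Gamma G f (laplacian G g) x - Gamma G g (laplacian G f) x) / 2"

definition CD_at :: "'a pair_pre_digraph \<Rightarrow> real \<Rightarrow> 'a \<Rightarrow> bool" where
  "CD_at G K x \<longleftrightarrow> (\<forall>f. Gamma2 G f f x \<ge> K * Gamma G f f x)"

definition CD :: "'a pair_pre_digraph \<Rightarrow> real \<Rightarrow> bool" where
  "CD G K \<longleftrightarrow> (\<forall>x\<in>pverts G. CD_at G K x)"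

text \<open>The supremum is taken in \<^typ>\<open>ereal\<close>, so that it is meaningful for every vertex
  (it is infinite at an isolated one).\<close>

definition curvature :: "'a pair_pre_digraph \<Rightarrow> 'a \<Rightarrow> ereal" where
  "curvature G x = (SUP K\<in>{K. CD_at G K x}. ereal K)"

global_interpretation fun_vs: vector_space "\<lambda>(c::real) (f :: 'a \<Rightarrow> real) x. c * f x"
  by unfold_locales (auto simp: fun_eq_iff algebra_simps)

text \<open>Functions on the vertex set are identified with those vanishing outside it, which makes
  the eigenspaces finite-dimensional.\<close>

definition eigenspace :: "'a pair_pre_digraph \<Rightarrow> real \<Rightarrow> ('a \<Rightarrow> real) set" where
  "eigenspace G \<mu> = {f. (\<forall>x\<in>pverts G. - laplacian G f x = \<mu> * f x) \<and>
                        (\<forall>x. x \<notin> pverts G \<longrightarrow> f x = 0)}"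

definition eigenvalues :: "'a pair_pre_digraph \<Rightarrow> real set" where
  "eigenvalues G = {\<mu>. \<exists>f\<in>eigenspace G \<mu>. \<exists>x\<in>pverts G. f x \<noteq> 0}"

definition spectrum_mset :: "'a pair_pre_digraph \<Rightarrow> real multiset" where
  "spectrum_mset G = (\<Sum>\<mu>\<in>eigenvalues G. replicate_mset (fun_vs.dim (eigenspace G \<mu>)) \<mu>)"

text \<open>Indexing starts at \<open>0\<close>; \<open>lambda G k\<close> is meaningful only for
  \<open>k < card (pverts G)\<close>.\<close>

definition lambda :: "'a pair_pre_digraph \<Rightarrow> nat \<Rightarrow> real" where
  "lambda G k = sorted_list_of_multiset (spectrum_mset G) ! k"

end

theory Submission
  imports Defs "HOL-Analysis.Function_Topology"
begin

text \<open>
  Let \<open>f\<close> be an eigenfunction of \<open>-L\<close> for the eigenvalue \<open>K\<close>. Inserting \<open>L f = - K f\<close> into the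
  definition of \<open>\<Gamma>\<^sub>2\<close> gives \<open>\<Gamma>\<^sub>2(f) - K \<Gamma>(f) = L \<Gamma>(f) / 2\<close>. The curvature condition makes this
  nonnegative at every vertex, while a Laplacian always sums to zero over the vertices; so
  \<open>L \<Gamma>(f) = 0\<close> and \<open>\<Gamma>\<^sub>2(f) = K \<Gamma>(f)\<close> everywhere (\<open>harmonic_Gamma\<close>).

  At a vertex \<open>x\<close> the quadratic form \<open>\<Gamma>\<^sub>2 - K \<Gamma>\<close> is positive semidefinite and vanishes at \<open>f\<close>, hence
  \<open>f\<close> is in its kernel: \<open>\<Gamma>\<^sub>2(f, g)(x) = K \<Gamma>(f, g)(x)\<close> for every \<open>g\<close>
  (\<open>Gamma2_eq_if_minimiser\<close>). Take for \<open>g\<close> the indicator of \<open>x\<close>. Both sides can then be computed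
  from \<open>L f(x) = - K f(x)\<close> alone, the degree of \<open>x\<close> cancels, and what is left is
  \<open>K f(x) / 2 + K\<^sup>2 f(x) / 4 = K\<^sup>2 f(x) / 2\<close>. At a vertex with \<open>f(x) \<noteq> 0\<close> this says \<open>K = 2\<close>
  (\<open>eigenvalue_eq_2\<close>).

  The curvature at \<open>x\<close> is at least \<open>K\<close> by assumption, and \<open>f\<close> is a test function showing that it is
  at most \<open>K\<close>, provided that \<open>\<Gamma>(f)(x) > 0\<close>. This holds at every vertex: since \<open>\<Gamma>(f)\<close> is
  nonnegative and harmonic, a zero would spread to all vertices by connectedness and make \<open>f\<close>
  harmonic, hence zero (\<open>Gamma_pos\<close>).

  It remains to see that \<open>lambda G 1\<close> really is an eigenvalue, that is, that the sorted list of
  eigenvalues has at least two entries. One eigenvalue is \<open>0\<close>; a nonzero one is found by minimising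
  the Dirichlet energy over the compact unit sphere of mean-zero functions
  (\<open>exists_nonzero_eigenvalue\<close>). The multiset of eigenvalues is a sum over the set of eigenvalues
  weighted by dimensions, so that set has to be finite and each eigenspace of finite positive
  dimension; both follow from embedding the eigenspaces in the span of the vertex indicators
  (\<open>set_spectrum_mset\<close>).
\<close>

section \<open>Calculus of the Laplacian and the Bakry--Emery forms\<close>

abbreviation nbrs :: "'a pair_pre_digraph \<Rightarrow> 'a \<Rightarrow> 'a set" where
  "nbrs G x \<equiv> {y. (x, y) \<in> parcs G}"

lemma laplacian_add_scale:
  "laplacian G (\<lambda>y. f y + t * g y) = (\<lambda>x. laplacian G f x + t * laplacian G g x)"
  by (rule ext)
    (simp add: laplacian_def sum_distrib_left sum.distrib[symmetric] algebra_simps)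

lemma Gamma_eq_sum:
  "Gamma G f g x = (\<Sum>y\<in>nbrs G x. (f y - f x) * (g y - g x)) / 2"
proof -
  have "laplacian G (\<lambda>y. f y * g y) x - f x * laplacian G g x - g x * laplacian G f x
      = (\<Sum>y\<in>nbrs G x. (f y * g y - f x * g x) - f x * (g y - g x) - g x * (f y - f x))"
    unfolding laplacian_def sum_distrib_left sum_subtractf[symmetric] ..
  also have "\<dots> = (\<Sum>y\<in>nbrs G x. (f y - f x) * (g y - g x))"
    by (rule sum.cong) (simp_all add: algebra_simps)
  finally show ?thesis by (simp add: Gamma_def)
qed

lemma Gamma_sym: "Gamma G f g = Gamma G g f"
  by (rule ext) (simp add: Gamma_eq_sum mult.commute)

lemma Gamma_add_scale_left:
  "Gamma G (\<lambda>y. f y + t * g y) h = (\<lambda>x. Gamma G f h x + t * Gamma G g h x)"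
proof
  fix x
  have "(\<Sum>y\<in>nbrs G x. (f y + t * g y - (f x + t * g x)) * (h y - h x))
      = (\<Sum>y\<in>nbrs G x. (f y - f x) * (h y - h x) + t * ((g y - g x) * (h y - h x)))"
    by (rule sum.cong) (simp_all add: algebra_simps)
  then show "Gamma G (\<lambda>y. f y + t * g y) h x = Gamma G f h x + t * Gamma G g h x"
    by (simp add: Gamma_eq_sum sum.distrib sum_distrib_left[symmetric] add_divide_distrib)
qed

lemma Gamma_add_scale_right:
  "Gamma G h (\<lambda>y. f y + t * g y) = (\<lambda>x. Gamma G h f x + t * Gamma G h g x)"
  by (simp add: Gamma_sym[of G h] Gamma_add_scale_left)

lemma Gamma2_add_scale:
  "Gamma2 G (\<lambda>y. f y + t * g y) (\<lambda>y. f y + t * g y) x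
     = Gamma2 G f f x + 2 * t * Gamma2 G f g x + t\<^sup>2 * Gamma2 G g g x"
proof -
  have "Gamma2 G (\<lambda>y. f y + t * g y) (\<lambda>y. f y + t * g y) x
      = (laplacian G (Gamma G f f) x + t * laplacian G (Gamma G f g) x
          + t * (laplacian G (Gamma G f g) x + t * laplacian G (Gamma G g g) x)
        - 2 * (Gamma G f (laplacian G f) x + t * Gamma G f (laplacian G g) x
          + t * (Gamma G g (laplacian G f) x + t * Gamma G g (laplacian G g) x))) / 2"
    unfolding Gamma2_def laplacian_add_scale Gamma_add_scale_left Gamma_add_scale_right
      Gamma_sym[of G g f]
    by (simp add: distrib_left)
  then show ?thesis
    by (simp add: Gamma2_def power2_eq_square field_simps)
qed

text \<open>
  This is the reason why a positive semidefinite form that vanishes at a vector has that vector in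
  its kernel: along a line through such a vector the form is \<open>2 t b + t\<^sup>2 c\<close>, which changes sign at
  \<open>t = 0\<close> unless \<open>b = 0\<close>.
\<close>

lemma linear_coeff_eq_0:
  fixes b c :: real
  assumes "\<And>t. 0 \<le> 2 * t * b + t\<^sup>2 * c"
  shows "b = 0"
proof (rule ccontr)
  assume b: "b \<noteq> 0"
  \<comment> \<open>Enlarging \<open>c\<close> to a positive \<open>d\<close> gives a parabola whose minimum, at \<open>t = - b / d\<close>, is negative.\<close>
  define d where "d = \<bar>c\<bar> + 1"
  have d: "d > 0" "c \<le> d" by (auto simp: d_def)
  have "0 \<le> 2 * (- b / d) * b + (- b / d)\<^sup>2 * c" by (rule assms)
  also have "\<dots> \<le> 2 * (- b / d) * b + (- b / d)\<^sup>2 * d"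
    using mult_left_mono[OF d(2), of "(- b / d)\<^sup>2"] by simp
  also have "\<dots> = - (b\<^sup>2 / d)"
    using d(1) by (simp add: power_divide power2_eq_square)
  also have "\<dots> < 0" using b d by simp
  finally show False by simp
qed

context pair_graph
begin

lemma nbrs_subset: "nbrs G x \<subseteq> pverts G"
  using in_arcsD2 by auto

lemma finite_nbrs: "finite (nbrs G x)"
  using nbrs_subset pair_finite_verts by (rule finite_subset)

lemma parcs_sym: "(x, y) \<in> parcs G \<longleftrightarrow> (y, x) \<in> parcs G"
  using pair_sym_arcs by (auto simp: symmetric_def sym_def)

lemma sum_nbrs_swap:
  fixes F :: "'a \<Rightarrow> 'a \<Rightarrow> real"
  shows "(\<Sum>x\<in>pverts G. \<Sum>y\<in>nbrs G x. F x y) = (\<Sum>x\<in>pverts G. \<Sum>y\<in>nbrs G x. F y x)"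
proof -
  have "(\<Sum>x\<in>pverts G. \<Sum>y\<in>nbrs G x. F x y)
      = (\<Sum>(x, y)\<in>Sigma (pverts G) (nbrs G). F x y)"
    using pair_finite_verts finite_nbrs by (subst sum.Sigma) auto
  also have "\<dots> = (\<Sum>(x, y)\<in>Sigma (pverts G) (nbrs G). F y x)"
    by (rule sum.reindex_bij_witness[where i = prod.swap and j = prod.swap])
      (auto simp: parcs_sym intro: in_arcsD1 in_arcsD2)
  also have "\<dots> = (\<Sum>x\<in>pverts G. \<Sum>y\<in>nbrs G x. F y x)"
    using pair_finite_verts finite_nbrs by (subst sum.Sigma) auto
  finally show ?thesis .
qed

lemma green_formula:
  "(\<Sum>x\<in>pverts G. g x * laplacian G f x) = - (\<Sum>x\<in>pverts G. Gamma G f g x)"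
proof -
  \<comment> \<open>Each edge is counted from both of its ends; averaging the two counts produces the gradients.\<close>
  have "2 * (\<Sum>x\<in>pverts G. g x * laplacian G f x)
      = (\<Sum>x\<in>pverts G. \<Sum>y\<in>nbrs G x. g x * (f y - f x))
      + (\<Sum>x\<in>pverts G. \<Sum>y\<in>nbrs G x. g y * (f x - f y))"
    by (subst (2) sum_nbrs_swap) (simp add: laplacian_def sum_distrib_left)
  also have "\<dots> = (\<Sum>x\<in>pverts G. \<Sum>y\<in>nbrs G x. - ((f y - f x) * (g y - g x)))"
    unfolding sum.distrib[symmetric] by (intro sum.cong) (simp_all add: algebra_simps)
  also have "\<dots> = - 2 * (\<Sum>x\<in>pverts G. Gamma G f g x)"
    by (simp add: Gamma_eq_sum sum_negf sum_divide_distrib[symmetric])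
  finally show ?thesis by simp
qed

lemma laplacian_self_adjoint:
  "(\<Sum>x\<in>pverts G. g x * laplacian G f x) = (\<Sum>x\<in>pverts G. f x * laplacian G g x)"
  by (simp add: green_formula Gamma_sym[of G f g])

lemma sum_laplacian: "(\<Sum>x\<in>pverts G. laplacian G f x) = 0"
  using green_formula[of "\<lambda>_. 1" f] by (simp add: Gamma_eq_sum)

lemma Gamma_nonneg: "0 \<le> Gamma G f f x"
  by (simp add: Gamma_eq_sum sum_nonneg)

lemma Gamma_eq_0_iff: "Gamma G f f x = 0 \<longleftrightarrow> (\<forall>y\<in>nbrs G x. f y = f x)"
  using finite_nbrs by (simp add: Gamma_eq_sum sum_nonneg_eq_0_iff)

lemma connected_induct:
  assumes "Digraph_Component.connected (with_proj G)"
    and "u \<in> pverts G" "v \<in> pverts G" "P u"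
    and "\<And>x y. (x, y) \<in> parcs G \<Longrightarrow> P x \<Longrightarrow> P y"
  shows "P v"
proof -
  have "strongly_connected (with_proj G)"
    using pair_sym_arcs assms(1) by (rule symmetric_connected_imp_strongly_connected)
  then have "u \<rightarrow>\<^sup>*\<^bsub>with_proj G\<^esub> v"
    using assms(2,3) by (auto simp: strongly_connected_def)
  then show ?thesis
    by (induction rule: reachable_induct) (use assms(4,5) in auto)
qed

lemma constant_if_Gamma_0:
  assumes "Digraph_Component.connected (with_proj G)"
    and "\<And>x. x \<in> pverts G \<Longrightarrow> Gamma G f f x = 0"
    and "u \<in> pverts G" "v \<in> pverts G"
  shows "f v = f u"
proof (rule connected_induct[OF assms(1,3,4)])
  fix x y assume "(x, y) \<in> parcs G" "f x = f u"
  then show "f y = f u"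
    using assms(2)[OF in_arcsD1] by (auto simp: Gamma_eq_0_iff)
qed simp

section \<open>Eigenfunctions attaining the curvature bound\<close>

lemma Gamma_laplacian_eigen:
  assumes "\<And>y. y \<in> pverts G \<Longrightarrow> - laplacian G f y = K * f y" and "x \<in> pverts G"
  shows "Gamma G g (laplacian G f) x = - K * Gamma G g f x"
proof -
  have eq: "laplacian G f y = - K * f y" if "y \<in> pverts G" for y
    using assms(1)[OF that] by simp
  have "(\<Sum>y\<in>nbrs G x. (g y - g x) * (laplacian G f y - laplacian G f x))
      = (\<Sum>y\<in>nbrs G x. - K * ((g y - g x) * (f y - f x)))"
  proof (rule sum.cong)
    fix y assume "y \<in> nbrs G x"
    then have "y \<in> pverts G" using nbrs_subset by auto
    then show "(g y - g x) * (laplacian G f y - laplacian G f x)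
        = - K * ((g y - g x) * (f y - f x))"
      by (simp only: eq assms(2)) (simp add: algebra_simps)
  qed simp
  then show ?thesis
    unfolding Gamma_eq_sum sum_distrib_left[symmetric] by simp
qed

text \<open>
  The function \<open>L \<Gamma>(f)\<close> is twice \<open>\<Gamma>\<^sub>2(f) - K \<Gamma>(f)\<close>, hence nonnegative; as it sums to zero over
  the graph, it vanishes.
\<close>

lemma harmonic_Gamma:
  assumes "CD G K" and eigen: "\<And>y. y \<in> pverts G \<Longrightarrow> - laplacian G f y = K * f y"
    and x: "x \<in> pverts G"
  shows "laplacian G (Gamma G f f) x = 0" and "Gamma2 G f f x = K * Gamma G f f x"
proof -
  have bochner: "Gamma2 G f f y = laplacian G (Gamma G f f) y / 2 + K * Gamma G f f y"
    if "y \<in> pverts G" for y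
    using Gamma_laplacian_eigen[of f K y f, OF eigen that] by (simp add: Gamma2_def)
  have nonneg: "laplacian G (Gamma G f f) y \<ge> 0" if "y \<in> pverts G" for y
  proof -
    have "Gamma2 G f f y \<ge> K * Gamma G f f y"
      using assms(1) that unfolding CD_def CD_at_def by blast
    then show ?thesis using bochner[OF that] by simp
  qed
  show *: "laplacian G (Gamma G f f) x = 0"
    using sum_nonneg_eq_0_iff[of _ "laplacian G (Gamma G f f)", OF pair_finite_verts nonneg]
      sum_laplacian[of "Gamma G f f"] x
    by blast
  show "Gamma2 G f f x = K * Gamma G f f x"
    using bochner[OF x] * by simp
qed

text \<open>
  The form \<open>\<Gamma>\<^sub>2 - K \<Gamma>\<close> at \<open>x\<close> is positive semidefinite by the curvature condition, and \<open>f\<close> is one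
  of its zeros.
\<close>

lemma Gamma2_eq_if_minimiser:
  assumes "CD_at G K x" and "Gamma2 G f f x = K * Gamma G f f x"
  shows "Gamma2 G f g x = K * Gamma G f g x"
proof -
  have "Gamma2 G f g x - K * Gamma G f g x = 0"
  proof (rule linear_coeff_eq_0)
    fix t
    let ?h = "\<lambda>y. f y + t * g y"
    have "0 \<le> Gamma2 G ?h ?h x - K * Gamma G ?h ?h x"
      using assms(1) by (simp add: CD_at_def)
    also have "\<dots> = 2 * t * (Gamma2 G f g x - K * Gamma G f g x)
        + t\<^sup>2 * (Gamma2 G g g x - K * Gamma G g g x)"
      unfolding Gamma2_add_scale using assms(2)
      by (simp add: Gamma_add_scale_left Gamma_add_scale_right Gamma_sym[of G g f]
          power2_eq_square algebra_simps)
    finally show "0 \<le> \<dots>" .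
  qed
  then show ?thesis by simp
qed

text \<open>
  The identity \<open>\<Gamma>\<^sub>2(f, \<delta>)(x) = K \<Gamma>(f, \<delta>)(x)\<close> is evaluated at the indicator \<open>\<delta>\<close> of \<open>x\<close>. All sums
  collapse to the star of \<open>x\<close>: edges between two neighbours of \<open>x\<close> and vertices at distance two do not
  contribute, because \<open>\<delta>\<close> vanishes at both ends of the edges involved. Therefore nothing about the graph
  beyond \<open>L f(x)\<close> and the degree of \<open>x\<close> enters.
\<close>

lemma eigenvalue_eq_2:
  assumes "CD G K" and eigen: "\<And>y. y \<in> pverts G \<Longrightarrow> - laplacian G f y = K * f y"
    and x: "x \<in> pverts G" and "f x \<noteq> 0" "K > 0"
  shows "K = 2"
proof -
  define \<delta> where "\<delta> = (\<lambda>y. if y = x then 1 else 0 :: real)"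
  define d where "d = real (card (nbrs G x))"
  have x_notin: "x \<notin> nbrs G x" using pair_no_loops by fastforce
  have Lf: "(\<Sum>y\<in>nbrs G x. f y - f x) = - K * f x"
    using eigen[OF x] by (simp add: laplacian_def)
  have \<delta>_nbr: "\<delta> y = 0" if "y \<in> nbrs G x" for y
    using that x_notin by (auto simp: \<delta>_def)
  have \<delta>_x: "\<delta> x = 1" by (simp add: \<delta>_def)
  \<comment> \<open>Seen from a neighbour \<open>y\<close>, the only vertex where \<open>\<delta>\<close> does not vanish is \<open>x\<close>.\<close>
  have only_x: "(\<Sum>z\<in>nbrs G y. F z * \<delta> z) = F x" if "y \<in> nbrs G x" for y and F :: "'a \<Rightarrow> real"
    using that finite_nbrs[of y] parcs_sym[of x y]
    by (simp add: \<delta>_def if_distrib cong: if_cong)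
  have L\<delta>_x: "laplacian G \<delta> x = - d"
    using \<delta>_nbr \<delta>_x by (simp add: laplacian_def d_def)
  have L\<delta>_nbr: "laplacian G \<delta> y = 1" if "y \<in> nbrs G x" for y
    using only_x[OF that, of "\<lambda>_. 1"] \<delta>_nbr[OF that] by (simp add: laplacian_def)
  have \<Gamma>_x: "Gamma G f \<delta> x = K * f x / 2"
  proof -
    have "(\<Sum>y\<in>nbrs G x. (f y - f x) * (\<delta> y - \<delta> x)) = (\<Sum>y\<in>nbrs G x. - (f y - f x))"
      by (rule sum.cong) (auto simp: \<delta>_nbr \<delta>_x)
    then show ?thesis unfolding Gamma_eq_sum sum_negf Lf by simp
  qed
  have \<Gamma>_nbr: "Gamma G f \<delta> y = - (f y - f x) / 2" if "y \<in> nbrs G x" for y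
    using only_x[OF that, of "\<lambda>z. f z - f y"] \<delta>_nbr[OF that] by (simp add: Gamma_eq_sum)
  have "laplacian G (Gamma G f \<delta>) x = (\<Sum>y\<in>nbrs G x. - (f y - f x) / 2 - K * f x / 2)"
    unfolding laplacian_def \<Gamma>_x by (rule sum.cong) (auto simp: \<Gamma>_nbr)
  also have "\<dots> = - (\<Sum>y\<in>nbrs G x. f y - f x) / 2 - d * (K * f x / 2)"
    by (simp only: sum_subtractf[of "\<lambda>y. - (f y - f x) / 2"] sum_divide_distrib[symmetric] sum_negf
        sum_constant d_def)
  finally have LG: "laplacian G (Gamma G f \<delta>) x = K * f x / 2 - d * (K * f x / 2)"
    unfolding Lf by simp
  have "(\<Sum>y\<in>nbrs G x. (f y - f x) * (laplacian G \<delta> y - laplacian G \<delta> x))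
      = (\<Sum>y\<in>nbrs G x. (f y - f x) * (1 + d))"
    by (rule sum.cong) (auto simp: L\<delta>_nbr L\<delta>_x)
  then have GL: "Gamma G f (laplacian G \<delta>) x = - K * f x * (1 + d) / 2"
    unfolding Gamma_eq_sum sum_distrib_right[symmetric] Lf by simp
  have "Gamma G \<delta> (laplacian G f) x = - K * (K * f x / 2)"
    using Gamma_laplacian_eigen[of f K x \<delta>, OF eigen x] \<Gamma>_x
    by (simp add: Gamma_sym[of G \<delta> f])
  \<comment> \<open>The terms with the degree in \<open>LG\<close> and \<open>GL\<close> cancel.\<close>
  with LG GL have "Gamma2 G f \<delta> x = K * f x / 2 + K * (K * f x / 2) / 2"
    by (simp add: Gamma2_def field_simps)
  moreover have "Gamma2 G f \<delta> x = K * Gamma G f \<delta> x"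
  proof (rule Gamma2_eq_if_minimiser)
    show "CD_at G K x" using assms(1) x unfolding CD_def by blast
    show "Gamma2 G f f x = K * Gamma G f f x" using assms(1) eigen x by (rule harmonic_Gamma)
  qed
  ultimately have "K * f x * 2 = K * f x * K"
    unfolding \<Gamma>_x by (simp add: field_simps)
  then show ?thesis using assms(4,5) by simp
qed

text \<open>
  A harmonic function that is nonnegative and vanishes at a vertex vanishes at all neighbours. So one
  zero of \<open>\<Gamma>(f)\<close> forces \<open>\<Gamma>(f) = 0\<close> on the whole connected graph, also at \<open>u\<close>, where then
  \<open>K f(u) = - L f(u) = 0\<close>.
\<close>

lemma Gamma_pos:
  assumes "Digraph_Component.connected (with_proj G)"
    and "CD G K" and eigen: "\<And>y. y \<in> pverts G \<Longrightarrow> - laplacian G f y = K * f y"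
    and "K > 0" "u \<in> pverts G" "f u \<noteq> 0" and x: "x \<in> pverts G"
  shows "Gamma G f f x > 0"
proof (rule ccontr)
  assume "\<not> ?thesis"
  then have zero: "Gamma G f f x = 0" using Gamma_nonneg[of f x] by simp
  have spread: "Gamma G f f z = 0" if arc: "(y, z) \<in> parcs G" and y: "Gamma G f f y = 0" for y z
  proof -
    have "(\<Sum>z\<in>nbrs G y. Gamma G f f z) = 0"
      using harmonic_Gamma(1)[OF assms(2) eigen in_arcsD1[OF arc]] y by (simp add: laplacian_def)
    then show ?thesis
      using arc finite_nbrs Gamma_nonneg by (simp add: sum_nonneg_eq_0_iff)
  qed
  have "Gamma G f f u = 0"
    using assms(1) x assms(5) zero spread by (rule connected_induct)
  then have "laplacian G f u = 0"
    by (simp add: Gamma_eq_0_iff laplacian_def)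
  with eigen[OF assms(5)] assms(4,6) show False by simp
qed

lemma curvature_eq:
  assumes "CD_at G K x" and "Gamma2 G f f x = K * Gamma G f f x" and "Gamma G f f x > 0"
  shows "curvature G x = ereal K"
  unfolding curvature_def
proof (rule antisym)
  show "(SUP K\<in>{K. CD_at G K x}. ereal K) \<le> ereal K"
  proof (rule SUP_least)
    fix K' assume "K' \<in> {K. CD_at G K x}"
    then have "K' * Gamma G f f x \<le> K * Gamma G f f x"
      unfolding CD_at_def assms(2)[symmetric] by blast
    then show "ereal K' \<le> ereal K" using assms(3) by simp
  qed
  show "ereal K \<le> (SUP K\<in>{K. CD_at G K x}. ereal K)"
    using assms(1) by (intro SUP_upper) simp
qed


section \<open>The spectrum\<close>

definition inner_on :: "('a \<Rightarrow> real) \<Rightarrow> ('a \<Rightarrow> real) \<Rightarrow> real" where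
  "inner_on f g = (\<Sum>x\<in>pverts G. f x * g x)"

lemma inner_on_self_eq_0_iff: "inner_on f f = 0 \<longleftrightarrow> (\<forall>x\<in>pverts G. f x = 0)"
  using pair_finite_verts by (simp add: inner_on_def sum_nonneg_eq_0_iff)

lemma eigenspace_orthogonal:
  assumes "f \<in> eigenspace G \<theta>" "g \<in> eigenspace G \<eta>" "\<theta> \<noteq> \<eta>"
  shows "inner_on f g = 0"
proof -
  have f: "laplacian G f x = - \<theta> * f x" if "x \<in> pverts G" for x
    using assms(1) that by (auto simp: eigenspace_def)
  have g: "laplacian G g x = - \<eta> * g x" if "x \<in> pverts G" for x
    using assms(2) that by (auto simp: eigenspace_def)
  have "(\<Sum>x\<in>pverts G. g x * laplacian G f x) = - \<theta> * inner_on f g"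
    unfolding inner_on_def sum_distrib_left by (rule sum.cong) (simp_all add: f)
  moreover have "(\<Sum>x\<in>pverts G. f x * laplacian G g x) = - \<eta> * inner_on f g"
    unfolding inner_on_def sum_distrib_left by (rule sum.cong) (simp_all add: g)
  ultimately have "\<theta> * inner_on f g = \<eta> * inner_on f g"
    using laplacian_self_adjoint[of g f] by linarith
  with assms(3) show ?thesis by auto
qed

text \<open>
  Pairing a linear relation with one of its members leaves only the coefficient of that member. The
  hypothesis on \<open>inner_on f f\<close> is more than \<open>f \<noteq> 0\<close>, since \<open>inner_on\<close> does not see values outside the
  vertex set.
\<close>

lemma independent_if_orthogonal:
  assumes "\<And>f. f \<in> S \<Longrightarrow> inner_on f f \<noteq> 0"
    and "\<And>f g. f \<in> S \<Longrightarrow> g \<in> S \<Longrightarrow> f \<noteq> g \<Longrightarrow> inner_on f g = 0"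
  shows "\<not> fun_vs.dependent S"
proof
  assume "fun_vs.dependent S"
  then obtain T u where T: "finite T" "T \<subseteq> S" and zero: "(\<Sum>f\<in>T. (\<lambda>x. u f * f x)) = 0"
    and "\<exists>f\<in>T. u f \<noteq> 0"
    unfolding fun_vs.dependent_explicit by blast
  then obtain g where g: "g \<in> T" "u g \<noteq> 0" by blast
  have "0 = inner_on (\<Sum>f\<in>T. (\<lambda>x. u f * f x)) g"
    by (simp add: zero inner_on_def)
  also have "\<dots> = (\<Sum>f\<in>T. u f * inner_on f g)"
  proof -
    have "(\<Sum>f\<in>T. (\<lambda>x. u f * f x)) x = (\<Sum>f\<in>T. u f * f x)" for x
      using T(1) by (induction T) auto
    then show ?thesis
      by (simp add: inner_on_def sum_distrib_left sum_distrib_right mult.assoc) (rule sum.swap)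
  qed
  also have "\<dots> = (\<Sum>f\<in>{g}. u f * inner_on f g)"
  proof (rule sum.mono_neutral_right)
    show "\<forall>f\<in>T - {g}. u f * inner_on f g = 0"
      using assms(2) T(2) g(1) by (metis DiffE insertI1 mult_zero_right subsetD)
  qed (use T(1) g(1) in auto)
  finally show False using assms(1) T(2) g by auto
qed

definition delta_on :: "('a \<Rightarrow> real) set" where
  "delta_on = (\<lambda>v x. if x = v then 1 else 0) ` pverts G"

lemma finite_delta_on: "finite delta_on"
  unfolding delta_on_def using pair_finite_verts by simp

text \<open>
  Finite dimensionality of the eigenspaces rests on the convention that their members vanish outside
  the vertex set.
\<close>

lemma eigenspace_subset_span: "eigenspace G \<theta> \<subseteq> fun_vs.span delta_on"
proof
  fix f assume "f \<in> eigenspace G \<theta>"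
  then have outside: "f x = 0" if "x \<notin> pverts G" for x
    using that by (simp add: eigenspace_def)
  have "f = (\<Sum>v\<in>pverts G. (\<lambda>x. f v * (if x = v then 1 else 0)))"
  proof
    fix x
    have "(\<Sum>v\<in>W. (\<lambda>x. f v * (if x = v then 1 else 0))) x = (\<Sum>v\<in>W. if x = v then f v else 0)"
      if "finite W" for W
      using that by (induction W) auto
    then show "f x = (\<Sum>v\<in>pverts G. (\<lambda>x. f v * (if x = v then 1 else 0))) x"
      using pair_finite_verts outside by simp
  qed
  also have "\<dots> \<in> fun_vs.span delta_on"
    by (intro fun_vs.span_sum fun_vs.span_scale fun_vs.span_base) (auto simp: delta_on_def)
  finally show "f \<in> fun_vs.span delta_on" .
qed

text \<open>
  Eigenfunctions chosen for distinct eigenvalues are orthogonal, hence independent, and they all lie in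
  the span of the finitely many vertex indicators.
\<close>

lemma finite_eigenvalues: "finite (eigenvalues G)"
proof -
  have "\<exists>f\<in>eigenspace G \<theta>. inner_on f f \<noteq> 0" if "\<theta> \<in> eigenvalues G" for \<theta>
    using that by (auto simp: eigenvalues_def inner_on_self_eq_0_iff)
  then obtain e where e: "e \<theta> \<in> eigenspace G \<theta>" "inner_on (e \<theta>) (e \<theta>) \<noteq> 0"
    if "\<theta> \<in> eigenvalues G" for \<theta>
    by metis
  have orth: "inner_on (e \<theta>) (e \<eta>) = 0"
    if "\<theta> \<in> eigenvalues G" "\<eta> \<in> eigenvalues G" "\<theta> \<noteq> \<eta>" for \<theta> \<eta>
    using e that by (intro eigenspace_orthogonal) auto
  have "\<not> fun_vs.dependent (e ` eigenvalues G)"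
    using e(2) orth by (intro independent_if_orthogonal) auto
  moreover have "e ` eigenvalues G \<subseteq> fun_vs.span delta_on"
    using e(1) eigenspace_subset_span by blast
  ultimately have "finite (e ` eigenvalues G)"
    using fun_vs.independent_span_bound finite_delta_on by blast
  moreover have "inj_on e (eigenvalues G)"
    using e(2) orth by (metis inj_onI)
  ultimately show ?thesis by (rule finite_imageD)
qed

lemma dim_eigenspace_pos:
  assumes "\<theta> \<in> eigenvalues G"
  shows "fun_vs.dim (eigenspace G \<theta>) > 0"
proof -
  obtain f x where f: "f \<in> eigenspace G \<theta>" "f x \<noteq> 0"
    using assms by (auto simp: eigenvalues_def)
  obtain B where B: "B \<subseteq> eigenspace G \<theta>" "\<not> fun_vs.dependent B"
      "eigenspace G \<theta> \<subseteq> fun_vs.span B" "card B = fun_vs.dim (eigenspace G \<theta>)"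
    using fun_vs.basis_exists by blast
  have "finite B"
    using fun_vs.independent_span_bound[OF finite_delta_on B(2)] B(1) eigenspace_subset_span
    by blast
  moreover have "B \<noteq> {}"
    using B(3) f by auto
  ultimately show ?thesis using B(4) by (metis card_gt_0_iff)
qed

text \<open>
  An eigenvalue occurs in the multiset only if its multiplicity is positive, and the sum over the
  eigenvalues is meaningful only if there are finitely many of them.
\<close>

lemma set_spectrum_mset: "set_mset (spectrum_mset G) = eigenvalues G"
  unfolding spectrum_mset_def set_mset_sum[OF finite_eigenvalues]
  using dim_eigenspace_pos by auto

lemma zero_eigenvalue:
  assumes "pverts G \<noteq> {}"
  shows "0 \<in> eigenvalues G"
proof -
  have "(\<lambda>x. if x \<in> pverts G then 1 else 0) \<in> eigenspace G 0"
    by (auto simp: eigenspace_def laplacian_def intro!: sum.neutral dest: in_arcsD2)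
  then show ?thesis using assms unfolding eigenvalues_def by force
qed

section \<open>Existence of a nonzero eigenvalue\<close>

definition energy :: "('a \<Rightarrow> real) \<Rightarrow> real" where
  "energy f = (\<Sum>x\<in>pverts G. Gamma G f f x)"

text \<open>
  In the product topology on functions, the sphere is a closed subset of a product of compact intervals.
  Fixing the values outside the vertex set is what makes it compact when the vertex type is
  infinite.
\<close>

lemma compact_mean_zero_sphere:
  "compact {f. (\<forall>x. x \<notin> pverts G \<longrightarrow> f x = 0) \<and> (\<Sum>x\<in>pverts G. f x) = 0 \<and> inner_on f f = 1}"
    (is "compact ?S")
proof -
  let ?box = "PiE UNIV (\<lambda>x. if x \<in> pverts G then {-1..1} else {0 :: real})"
  have "compactin (product_topology (\<lambda>_. euclidean) UNIV) ?box"
    unfolding compactin_PiE by (auto simp: compactin_euclidean_iff)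
  then have "compact ?box"
    by (simp add: euclidean_product_topology compactin_euclidean_iff)
  moreover have "closed {f :: 'a \<Rightarrow> real. (\<Sum>x\<in>pverts G. f x) = 0 \<and> inner_on f f = 1}"
    unfolding inner_on_def
    by (intro closed_Collect_conj closed_Collect_eq continuous_intros continuous_on_product_coordinates)
  ultimately have "compact (?box \<inter> {f. (\<Sum>x\<in>pverts G. f x) = 0 \<and> inner_on f f = 1})"
    by (rule compact_Int_closed)
  moreover have "?S = ?box \<inter> {f. (\<Sum>x\<in>pverts G. f x) = 0 \<and> inner_on f f = 1}"
  proof -
    have "f x \<in> {-1..1}" if "inner_on f f = 1" "x \<in> pverts G" for f :: "'a \<Rightarrow> real" and x
    proof -
      have "f x * f x \<le> inner_on f f"
        unfolding inner_on_def using that(2) pair_finite_verts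
        by (intro member_le_sum) auto
      then have "\<bar>f x\<bar> \<le> 1"
        using that(1) abs_square_le_1[of "f x"] by (simp add: power2_eq_square)
      then show ?thesis by (simp add: abs_le_iff)
    qed
    then show ?thesis by (auto simp: PiE_iff split: if_splits)
  qed
  ultimately show ?thesis by simp
qed

lemma inner_on_add_scale:
  "inner_on (\<lambda>x. f x + t * g x) (\<lambda>x. f x + t * g x)
     = inner_on f f + 2 * t * inner_on f g + t\<^sup>2 * inner_on g g"
  unfolding inner_on_def sum_distrib_left sum.distrib[symmetric]
  by (rule sum.cong) (simp_all add: power2_eq_square algebra_simps)

lemma energy_add_scale:
  "energy (\<lambda>x. f x + t * g x)
     = energy f - 2 * t * (\<Sum>x\<in>pverts G. g x * laplacian G f x) + t\<^sup>2 * energy g"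
  unfolding energy_def green_formula Gamma_add_scale_left Gamma_add_scale_right Gamma_sym[of G g f]
  by (simp add: sum.distrib sum_distrib_left power2_eq_square algebra_simps)

text \<open>
  Let \<open>g\<close> minimise the Dirichlet energy among mean-zero functions of norm \<open>1\<close>, with minimum \<open>\<theta>\<close>.
  By homogeneity \<open>energy - \<theta> inner_on\<close> is positive semidefinite on mean-zero functions, and it
  vanishes at \<open>g\<close>. So \<open>g\<close> is in its kernel, which by Green's formula means that \<open>L g + \<theta> g\<close> is
  orthogonal to all mean-zero functions, itself among them. Finally \<open>\<theta> \<noteq> 0\<close>, as on a connected graph
  only constants have energy zero.
\<close>

lemma exists_nonzero_eigenvalue:
  assumes conn: "Digraph_Component.connected (with_proj G)" and card: "card (pverts G) \<ge> 2"
  shows "\<exists>\<theta>\<in>eigenvalues G. \<theta> \<noteq> 0"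
proof -
  define S where "S = {f. (\<forall>x. x \<notin> pverts G \<longrightarrow> f x = 0) \<and> (\<Sum>x\<in>pverts G. f x) = 0
      \<and> inner_on f f = 1}"
  have normalise: "(\<lambda>x. if x \<in> pverts G then f x / sqrt (inner_on f f) else 0) \<in> S"
    if "(\<Sum>x\<in>pverts G. f x) = 0" and nz: "inner_on f f \<noteq> 0" for f
  proof -
    have "inner_on f f \<ge> 0" by (simp add: inner_on_def sum_nonneg)
    then show ?thesis
      using that unfolding S_def inner_on_def
      by (simp add: sum_divide_distrib[symmetric])
  qed
  have "S \<noteq> {}"
  proof -
    obtain u v where uv: "u \<in> pverts G" "v \<in> pverts G" "u \<noteq> v"
      using card by (auto simp: numeral_2_eq_2 card_le_Suc_iff)
    define f :: "'a \<Rightarrow> real" where "f = (\<lambda>x. (if x = u then 1 else 0) - (if x = v then 1 else 0))"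
    have "(\<Sum>x\<in>pverts G. f x) = 0"
      using uv pair_finite_verts by (simp add: f_def sum_subtractf)
    moreover have "inner_on f f \<noteq> 0"
      unfolding inner_on_self_eq_0_iff using uv by (auto simp: f_def)
    ultimately show ?thesis using normalise by blast
  qed
  moreover have "continuous_on S energy"
    unfolding energy_def Gamma_eq_sum
    by (intro continuous_intros continuous_on_subset[OF continuous_on_product_coordinates]) auto
  ultimately obtain g where g: "g \<in> S" and least: "\<And>f. f \<in> S \<Longrightarrow> energy g \<le> energy f"
    using continuous_attains_inf[of S energy] compact_mean_zero_sphere unfolding S_def by blast
  have g': "(\<Sum>x\<in>pverts G. g x) = 0" "inner_on g g = 1" "\<And>x. x \<notin> pverts G \<Longrightarrow> g x = 0"
    using g by (auto simp: S_def)
  define \<theta> where "\<theta> = energy g"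
  have rayleigh: "\<theta> * inner_on f f \<le> energy f" if f: "(\<Sum>x\<in>pverts G. f x) = 0" for f
  proof (cases "inner_on f f = 0")
    case True
    then show ?thesis by (simp add: energy_def sum_nonneg Gamma_nonneg)
  next
    case False
    define c where "c = sqrt (inner_on f f)"
    have "inner_on f f \<ge> 0" by (simp add: inner_on_def sum_nonneg)
    with False have c: "c > 0" "c\<^sup>2 = inner_on f f" by (auto simp: c_def)
    let ?h = "\<lambda>x. if x \<in> pverts G then f x / c else 0"
    have "Gamma G ?h ?h x = Gamma G f f x / c\<^sup>2" if "x \<in> pverts G" for x
    proof -
      have "(\<Sum>y\<in>nbrs G x. (?h y - ?h x) * (?h y - ?h x))
          = (\<Sum>y\<in>nbrs G x. ((f y - f x) * (f y - f x)) / c\<^sup>2)"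
        using that nbrs_subset
        by (intro sum.cong) (auto simp: power2_eq_square diff_divide_distrib[symmetric])
      then show ?thesis by (simp add: Gamma_eq_sum sum_divide_distrib[symmetric])
    qed
    then have "energy ?h = energy f / c\<^sup>2"
      by (simp add: energy_def sum_divide_distrib)
    moreover have "\<theta> \<le> energy ?h"
      unfolding \<theta>_def using normalise[OF f False, folded c_def] by (rule least)
    moreover have "inner_on f f > 0"
      using c by (metis zero_less_power)
    ultimately show ?thesis using c(2) by (simp add: pos_le_divide_eq)
  qed
  define r where "r = (\<lambda>x. laplacian G g x + \<theta> * g x)"
  have r_mean: "(\<Sum>x\<in>pverts G. r x) = 0"
    by (simp add: r_def sum.distrib sum_laplacian sum_distrib_left[symmetric] g'(1))
  \<comment> \<open>The residual \<open>r\<close> is an admissible variation of \<open>g\<close>, and the first variation in its own direction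
    is minus its squared norm.\<close>
  have "- inner_on r r = 0"
  proof (rule linear_coeff_eq_0)
    fix t
    have "0 \<le> energy (\<lambda>x. g x + t * r x)
        - \<theta> * inner_on (\<lambda>x. g x + t * r x) (\<lambda>x. g x + t * r x)"
      using rayleigh[of "\<lambda>x. g x + t * r x"] r_mean g'(1)
      by (simp add: sum.distrib sum_distrib_left[symmetric])
    also have "\<dots> = - 2 * t * ((\<Sum>x\<in>pverts G. r x * laplacian G g x) + \<theta> * inner_on g r)
        + t\<^sup>2 * (energy r - \<theta> * inner_on r r)"
      unfolding energy_add_scale inner_on_add_scale g'(2) by (simp add: \<theta>_def algebra_simps)
    also have "(\<Sum>x\<in>pverts G. r x * laplacian G g x) + \<theta> * inner_on g r = inner_on r r"
      unfolding inner_on_def sum_distrib_left sum.distrib[symmetric]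
      by (rule sum.cong) (simp_all add: r_def algebra_simps)
    finally show "0 \<le> 2 * t * - inner_on r r + t\<^sup>2 * (energy r - \<theta> * inner_on r r)" by simp
  qed
  then have "g \<in> eigenspace G \<theta>"
    using g'(3) by (auto simp: inner_on_self_eq_0_iff r_def eigenspace_def)
  moreover have "\<exists>x\<in>pverts G. g x \<noteq> 0"
    using g'(2) inner_on_self_eq_0_iff[of g] by auto
  ultimately have "\<theta> \<in> eigenvalues G" by (auto simp: eigenvalues_def)
  moreover have "\<theta> \<noteq> 0"
  proof
    assume "\<theta> = 0"
    then have flat: "Gamma G g g x = 0" if "x \<in> pverts G" for x
      using that pair_finite_verts Gamma_nonneg
      by (simp add: \<theta>_def energy_def sum_nonneg_eq_0_iff)
    obtain u where u: "u \<in> pverts G" "g u \<noteq> 0" using \<open>\<exists>x\<in>pverts G. g x \<noteq> 0\<close> by blast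
    have "(\<Sum>x\<in>pverts G. g x) = (\<Sum>x\<in>pverts G. g u)"
      using constant_if_Gamma_0[OF conn flat u(1)] by (intro sum.cong) auto
    with g'(1) u card show False by simp
  qed
  ultimately show ?thesis by blast
qed

text \<open>
  Indexing the sorted list at \<open>1\<close> yields one of its entries only because the list has length at least
  two, which the two distinct eigenvalues \<open>0\<close> and \<open>\<theta>\<close> guarantee.
\<close>

lemma lambda_1_eigenvalue:
  assumes "Digraph_Component.connected (with_proj G)" and "card (pverts G) \<ge> 2"
  shows "lambda G 1 \<in> eigenvalues G"
proof -
  obtain \<theta> where "\<theta> \<in> eigenvalues G" "\<theta> \<noteq> 0"
    using exists_nonzero_eigenvalue[OF assms] by blast
  moreover have "0 \<in> eigenvalues G"
    using assms(2) by (intro zero_eigenvalue) auto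
  ultimately have "card {0, \<theta>} \<le> card (set_mset (spectrum_mset G))"
    unfolding set_spectrum_mset by (intro card_mono finite_eigenvalues) auto
  also have "\<dots> \<le> length (sorted_list_of_multiset (spectrum_mset G))"
    using card_length[of "sorted_list_of_multiset (spectrum_mset G)"] by simp
  finally have "1 < length (sorted_list_of_multiset (spectrum_mset G))"
    using \<open>\<theta> \<noteq> 0\<close> by simp
  then have "lambda G 1 \<in> set (sorted_list_of_multiset (spectrum_mset G))"
    unfolding lambda_def by (rule nth_mem)
  then show ?thesis by (simp add: set_spectrum_mset)
qed

end

section \<open>Rigidity\<close>

theorem theorem4p1:
  fixes G :: "'a pair_pre_digraph" and K :: real
  assumes "pair_graph G"
    and "Digraph_Component.connected (with_proj G)"
    and "card (pverts G) \<ge> 2"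
    and "CD G K"
    and "K > 0"
    and "lambda G 1 = K"
  shows "\<forall>x\<in>pverts G. ereal K = curvature G x \<and> curvature G x = 2"
proof
  fix x assume x: "x \<in> pverts G"
  interpret pair_graph G by fact
  have "K \<in> eigenvalues G"
    using lambda_1_eigenvalue[OF assms(2,3)] assms(6) by simp
  then obtain f u where f: "f \<in> eigenspace G K" and u: "u \<in> pverts G" "f u \<noteq> 0"
    by (auto simp: eigenvalues_def)
  have eigen: "- laplacian G f y = K * f y" if "y \<in> pverts G" for y
    using f that by (simp add: eigenspace_def)
  have "K = 2"
    using assms(4) eigen u assms(5) by (rule eigenvalue_eq_2)
  moreover have "curvature G x = ereal K"
  proof (rule curvature_eq)
    show "CD_at G K x" using assms(4) x unfolding CD_def by blast
    show "Gamma2 G f f x = K * Gamma G f f x" using assms(4) eigen x by (rule harmonic_Gamma)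
    show "Gamma G f f x > 0" using assms(2,4) eigen assms(5) u x by (rule Gamma_pos)
  qed
  ultimately show "ereal K = curvature G x \<and> curvature G x = 2" by simp
qed

end
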